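(* Let $N\ge 1$ be an integer, let $\delta, c, f_c, \Delta f, P_T, \sigma_c^2, \sigma_n^2 > 0$ and $\phi\in\mathbb{R}$ be real constants, and let $\gamma\in\mathbb{C}$ be a constant. For the weakly coupled uniform linear array with $N$ elements under phase-controlled analog beamforming, whose received SNR at frequency $f$ is $$\mathrm{SNR}_{\mathrm{CONV}}^{\mathrm{WC}}(f)=\frac{|\gamma|^2\sigma_c^2\,|\bm{a}^H(f_c)\bm{a}(f)|^2P_T}{\sigma_n^2\,\bm{a}^H(f_c)\bm{a}(f_c)},$$ the average received SNR over the bandwidth $\Delta f$, $$\overline{\mathrm{SNR}}_{\mathrm{CONV}}^{\mathrm{WC}}(\Delta f)=\frac{1}{\Delta f}\int_{f_c-\Delta f/2}^{f_c+\Delta f/2}\mathrm{SNR}_{\mathrm{CONV}}^{\mathrm{WC}}(f)\,df,$$ is given by $$\overline{\mathrm{SNR}}_{\mathrm{CONV}}^{\mathrm{WC}}(\Delta f)=\frac{|\gamma|^2\sigma_c^2P_T}{\sigma_n^2}\left[1+2\sum_{m=1}^{N-1}\left(1-\frac{m}{N}\right)\mathrm{sinc}\!\left(\pi\frac{\delta}{c}\,m\,\Delta f\sin(\phi)\right)\right].$$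
   Context: The steering vector of the array at frequency $f$ is $\bm{a}(f)=[1,\,e^{j2\pi f\frac{\delta}{c}\sin(\phi)},\,\ldots,\,e^{j2\pi f\frac{\delta}{c}(N-1)\sin(\phi)}]^T\in\mathbb{C}^{N}$, where $j$ is the imaginary unit, $\delta$ is the inter-element separation, $c$ the speed of light, and $\phi$ the angle of arrival with respect to broadside. The superscript $H$ denotes conjugate transpose. Phase-controlled analog beamforming uses the fixed weight vector $\bm{w}=\bm{a}(f_c)$ designed at the centre frequency $f_c$. In the weakly coupled model, the coupling matrix and the noise covariance matrix are multiples of the identity, and the scalars $\gamma$ (circuit/channel gain), $\sigma_c^2$ (coupling) and $\sigma_n^2$ (noise) are treated as constants, independent of frequency over the band; $P_T$ is the transmit power. The sinc function is unnormalized: $\mathrm{sinc}(x)=\sin(x)/x$ for $x\neq 0$ and $\mathrm{sinc}(0)=1$. *)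

theory Defs
  imports "HOL-Analysis.Analysis" "HOL-Probability.Sinc_Integral" "Jordan_Normal_Form.Matrix"
begin

definition steering :: "nat \<Rightarrow> real \<Rightarrow> real \<Rightarrow> real \<Rightarrow> real \<Rightarrow> complex Matrix.vec" where
  "steering N \<delta> c \<phi> f =
     Matrix.vec N (\<lambda>n. exp (\<i> * complex_of_real (2 * pi * f * (\<delta> / c) * real n * sin \<phi>)))"

text \<open>
  The Hermitian product \<open>u \<bullet>c v\<close> conjugates its second argument, so the product of the
  conjugate transpose of \<open>v\<close> with \<open>u\<close>, usually written \<open>v\<^sup>H u\<close>, is \<open>u \<bullet>c v\<close>.  The scalar
  \<open>v\<^sup>H v\<close> is real; \<open>Re\<close> below only moves it to type \<^typ>\<open>real\<close>.
\<close>

definition snr_conv_wc ::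
  "nat \<Rightarrow> real \<Rightarrow> real \<Rightarrow> real \<Rightarrow> complex \<Rightarrow> real \<Rightarrow> real \<Rightarrow> real \<Rightarrow> real \<Rightarrow> real \<Rightarrow> real" where
  "snr_conv_wc N \<delta> c \<phi> \<gamma> \<sigma>\<^sub>c \<sigma>\<^sub>n P\<^sub>T f\<^sub>c f =
     (let a = steering N \<delta> c \<phi> in
       ((cmod \<gamma>)\<^sup>2 * \<sigma>\<^sub>c\<^sup>2 * (cmod (a f \<bullet>c a f\<^sub>c))\<^sup>2 * P\<^sub>T) /
       (\<sigma>\<^sub>n\<^sup>2 * Re (a f\<^sub>c \<bullet>c a f\<^sub>c)))"

definition avg_snr_conv_wc ::
  "nat \<Rightarrow> real \<Rightarrow> real \<Rightarrow> real \<Rightarrow> complex \<Rightarrow> real \<Rightarrow> real \<Rightarrow> real \<Rightarrow> real \<Rightarrow> real \<Rightarrow> real" where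
  "avg_snr_conv_wc N \<delta> c \<phi> \<gamma> \<sigma>\<^sub>c \<sigma>\<^sub>n P\<^sub>T f\<^sub>c \<Delta>f =
     1 / \<Delta>f * integral {f\<^sub>c - \<Delta>f / 2 .. f\<^sub>c + \<Delta>f / 2}
                 (\<lambda>f. snr_conv_wc N \<delta> c \<phi> \<gamma> \<sigma>\<^sub>c \<sigma>\<^sub>n P\<^sub>T f\<^sub>c f)"

end

theory Submission
  imports Defs
begin

text \<open>
  The squared modulus of the geometric sum \<open>a\<^sup>H(f\<^sub>c) a(f)\<close> is the Fejer kernel
  \<open>N + 2 \<Sum> (N - m) cos (m t)\<close> at \<open>t = 2 \<pi> (f - f\<^sub>c) (\<delta> / c) sin \<phi>\<close>, and integrating a
  cosine over an interval symmetric about its centre gives a sinc.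
\<close>

text \<open>Each pair of distinct terms contributes twice the cosine of its phase difference, and N
  - m pairs lie at distance m. In the induction the new term of index N meets every earlier term
  once, at the distances 1 to N, and adds 1 for its own modulus.\<close>

lemma cmod_sum_cis_squared:
  fixes t :: real
  shows "(cmod (\<Sum>n<N. cis (real n * t)))\<^sup>2 =
    real N + 2 * (\<Sum>m = 1..<N. (real N - real m) * cos (real m * t))"
proof (induction N)
  case 0
  show ?case by simp
next
  case (Suc N)
  let ?S = "\<Sum>n<N. cis (real n * t)"
  have "Re (?S * cnj (cis (real N * t))) = (\<Sum>n<N. cos (real (N - n) * t))"
    unfolding sum_distrib_right Re_sum
    by (rule sum.cong) (simp_all add: of_nat_diff left_diff_distrib cos_diff)
  also have "\<dots> = (\<Sum>m = 1..N. cos (real m * t))"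
    by (rule sum.reindex_bij_witness[of _ "\<lambda>m. N - m" "\<lambda>n. N - n"]) auto
  finally have cross: "Re (?S * cnj (cis (real N * t))) = (\<Sum>m = 1..N. cos (real m * t))" .
  have "(cmod (\<Sum>n<Suc N. cis (real n * t)))\<^sup>2 =
      (cmod ?S)\<^sup>2 + 2 * Re (?S * cnj (cis (real N * t))) + 1"
  proof -
    have "(cmod (z + cis s))\<^sup>2 = (cmod z)\<^sup>2 + 2 * Re (z * cnj (cis s)) + 1" for z s
      using sin_cos_squared_add[of s] unfolding cmod_power2 by (simp add: power2_sum algebra_simps)
    then show ?thesis by simp
  qed
  also have "\<dots> = real N + 1 + 2 * ((\<Sum>m = 1..<N. (real N - real m) * cos (real m * t)) +
      (\<Sum>m = 1..N. cos (real m * t)))"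
    unfolding Suc.IH cross by simp
  \<comment> \<open>The summand at m = N has coefficient zero. Including it gives both sums the
    range of the next case, where the coefficients add up to N + 1 - m.\<close>
  also have "(\<Sum>m = 1..<N. (real N - real m) * cos (real m * t)) =
      (\<Sum>m = 1..N. (real N - real m) * cos (real m * t))"
    by (rule sum.mono_neutral_left) auto
  finally show ?case
    by (simp add: atLeastLessThanSuc_atLeastAtMost algebra_simps flip: sum.distrib)
qed

text \<open>The antiderivative \<open>sin (k * (f - x)) / k\<close> is odd about x, so the endpoints
  add up. It needs k nonzero; for k = 0, which occurs below when \<open>sin \<phi>\<close> = 0, the
  integrand is 1 and \<open>sinc 0\<close> = 1 gives the length d.\<close>

lemma has_integral_cos_symmetric:
  fixes k x d :: real
  assumes "d \<ge> 0"
  shows "((\<lambda>f. cos (k * (f - x))) has_integral d * sinc (k * d / 2)) {x - d / 2 .. x + d / 2}"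
proof (cases "k = 0")
  case True
  then show ?thesis
    using has_integral_const_real[of "1::real" "x - d / 2" "x + d / 2"] assms by (simp add: True)
next
  case False
  have "((\<lambda>f. cos (k * (f - x))) has_integral
      sin (k * (x + d / 2 - x)) / k - sin (k * (x - d / 2 - x)) / k) {x - d / 2 .. x + d / 2}"
    using False assms
    by (intro fundamental_theorem_of_calculus)
      (auto intro!: derivative_eq_intros simp flip: has_real_derivative_iff_has_vector_derivative)
  moreover have "sin (k * (x + d / 2 - x)) / k - sin (k * (x - d / 2 - x)) / k = d * sinc (k * d / 2)"
    using False by (cases "d = 0") (auto simp: field_simps)
  ultimately show ?thesis by simp
qed

text \<open>Conjugation subtracts the phases element by element, so only the offset f - g survives,
  and the product takes the form of the sum in \<open>cmod_sum_cis_squared\<close>.\<close>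

lemma steering_inner:
  "steering N \<delta> c \<phi> f \<bullet>c steering N \<delta> c \<phi> g =
    (\<Sum>n<N. cis (real n * (2 * pi * (\<delta> / c) * sin \<phi> * (f - g))))"
proof -
  have steering_cis: "steering N \<delta> c \<phi> h = Matrix.vec N (\<lambda>n. cis (2 * pi * h * (\<delta> / c) * real n * sin \<phi>))" for h
    unfolding steering_def cis_conv_exp ..
  have "cis (2 * pi * f * (\<delta> / c) * real n * sin \<phi>) * cnj (cis (2 * pi * g * (\<delta> / c) * real n * sin \<phi>)) =
      cis (real n * (2 * pi * (\<delta> / c) * sin \<phi> * (f - g)))" for n
    unfolding cis_cnj cis_mult by (rule arg_cong[where f = cis]) (simp add: algebra_simps diff_divide_distrib)
  then show ?thesis
    unfolding steering_cis by (simp add: scalar_prod_def atLeast0LessThan)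
qed

theorem theorem1:
  fixes N :: nat
    and \<delta> c f\<^sub>c \<Delta>f P\<^sub>T \<sigma>\<^sub>c \<sigma>\<^sub>n \<phi> :: real
    and \<gamma> :: complex
  assumes "N \<ge> 1"
    and "\<delta> > 0" and "c > 0" and "f\<^sub>c > 0" and "\<Delta>f > 0" and "P\<^sub>T > 0"
    and "\<sigma>\<^sub>c\<^sup>2 > 0" and "\<sigma>\<^sub>n\<^sup>2 > 0"
  shows "avg_snr_conv_wc N \<delta> c \<phi> \<gamma> \<sigma>\<^sub>c \<sigma>\<^sub>n P\<^sub>T f\<^sub>c \<Delta>f =
    ((cmod \<gamma>)\<^sup>2 * \<sigma>\<^sub>c\<^sup>2 * P\<^sub>T) / \<sigma>\<^sub>n\<^sup>2 *
      (1 + 2 * (\<Sum>m = 1..N - 1. (1 - real m / real N) * sinc (pi * (\<delta> / c) * real m * \<Delta>f * sin \<phi>)))"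
proof -
  define A where "A = (cmod \<gamma>)\<^sup>2 * \<sigma>\<^sub>c\<^sup>2 * P\<^sub>T / \<sigma>\<^sub>n\<^sup>2"
  \<comment> \<open>The phase step between neighbouring elements per unit of frequency
    offset.\<close>
  define \<kappa> where "\<kappa> = 2 * pi * (\<delta> / c) * sin \<phi>"
  let ?I = "{f\<^sub>c - \<Delta>f / 2 .. f\<^sub>c + \<Delta>f / 2}"
  have range: "{1..N - 1} = {1..<N}"
    using assms(1) by auto
  have arg: "real m * \<kappa> * \<Delta>f / 2 = pi * (\<delta> / c) * real m * \<Delta>f * sin \<phi>" for m
    by (simp add: \<kappa>_def)
  have snr: "snr_conv_wc N \<delta> c \<phi> \<gamma> \<sigma>\<^sub>c \<sigma>\<^sub>n P\<^sub>T f\<^sub>c f =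
      A * (1 + 2 * (\<Sum>m = 1..<N. (1 - real m / real N) * cos (real m * \<kappa> * (f - f\<^sub>c))))" for f
  proof -
    \<comment> \<open>The denominator is the same inner product at offset zero: every term is 1, so
      it equals N.\<close>
    have "snr_conv_wc N \<delta> c \<phi> \<gamma> \<sigma>\<^sub>c \<sigma>\<^sub>n P\<^sub>T f\<^sub>c f =
        A * ((real N + 2 * (\<Sum>m = 1..<N. (real N - real m) * cos (real m * (\<kappa> * (f - f\<^sub>c))))) / real N)"
      unfolding snr_conv_wc_def Let_def steering_inner cmod_sum_cis_squared \<kappa>_def[symmetric] A_def
      by simp
    also have "(real N + 2 * (\<Sum>m = 1..<N. (real N - real m) * cos (real m * (\<kappa> * (f - f\<^sub>c))))) / real N =
        1 + 2 * (\<Sum>m = 1..<N. (1 - real m / real N) * cos (real m * \<kappa> * (f - f\<^sub>c)))"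
      using assms(1)
      by (auto simp: add_divide_distrib sum_distrib_left sum_divide_distrib field_simps intro!: sum.cong)
    finally show ?thesis .
  qed
  \<comment> \<open>The finite sum is integrated term by term, with frequency
    \<open>k = real m * \<kappa>\<close> in each cosine.\<close>
  have "((\<lambda>f. A * (1 + 2 * (\<Sum>m = 1..<N. (1 - real m / real N) * cos (real m * \<kappa> * (f - f\<^sub>c)))))
      has_integral A * (\<Delta>f + 2 * (\<Sum>m = 1..<N. (1 - real m / real N) *
        (\<Delta>f * sinc (real m * \<kappa> * \<Delta>f / 2))))) ?I"
    using assms(5) has_integral_const_real[of "1::real" "f\<^sub>c - \<Delta>f / 2" "f\<^sub>c + \<Delta>f / 2"]
    by (intro has_integral_mult_right has_integral_add has_integral_sum has_integral_cos_symmetric)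
      auto
  then have "integral ?I (\<lambda>f. snr_conv_wc N \<delta> c \<phi> \<gamma> \<sigma>\<^sub>c \<sigma>\<^sub>n P\<^sub>T f\<^sub>c f) =
      A * (\<Delta>f + 2 * (\<Sum>m = 1..<N. (1 - real m / real N) * (\<Delta>f * sinc (real m * \<kappa> * \<Delta>f / 2))))"
    unfolding snr by (rule integral_unique)
  also have "\<dots> = \<Delta>f * (A * (1 + 2 * (\<Sum>m = 1..<N. (1 - real m / real N) *
      sinc (pi * (\<delta> / c) * real m * \<Delta>f * sin \<phi>))))"
    unfolding arg distrib_left sum_distrib_left by (simp add: mult.left_commute)
  finally show ?thesis
    using assms(5) unfolding avg_snr_conv_wc_def range A_def by simp
qed

end
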